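(* Let $G$ be a bipartite graph with bipartition $\{B,R\}$, where $m:=|B|\ge 1$, $n:=|R|\ge 1$ and $m\le n$, and let $k$ be an integer with $1\le k\le m+n-1$. If $G$ has a perfect matching and $k$ is odd, then $\beta(F_k(G))=\binom{m+n}{k}/2$.
   Context: For a simple finite graph $G$ of order $N$ and an integer $1\le k\le N-1$, the $k$-token graph $F_k(G)$ is the graph whose vertices are all $k$-element subsets of $V(G)$, two such subsets being adjacent iff their symmetric difference is an edge of $G$. $\beta$ denotes the independence number. A perfect matching is a matching covering every vertex. *)

theory Defs
  imports Complex_Main "HOL-Library.Ramsey"
begin

record 'a graph =
  verts :: "'a set"
  edges :: "'a set set"

definition fin_simple_graph :: "'a graph \<Rightarrow> bool" where
  "fin_simple_graph G \<longleftrightarrow> finite (verts G) \<and> edges G \<subseteq> [verts G]\<^bsup>2\<^esup>"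

definition bipartition :: "'a graph \<Rightarrow> 'a set \<Rightarrow> 'a set \<Rightarrow> bool" where
  "bipartition G B R \<longleftrightarrow>
     B \<union> R = verts G \<and> B \<inter> R = {} \<and> (\<forall>e\<in>edges G. \<exists>b\<in>B. \<exists>r\<in>R. e = {b, r})"

definition matching :: "'a graph \<Rightarrow> 'a set set \<Rightarrow> bool" where
  "matching G M \<longleftrightarrow> M \<subseteq> edges G \<and> (\<forall>e\<in>M. \<forall>f\<in>M. e \<noteq> f \<longrightarrow> e \<inter> f = {})"

definition perfect_matching :: "'a graph \<Rightarrow> 'a set set \<Rightarrow> bool" where
  "perfect_matching G M \<longleftrightarrow> matching G M \<and> verts G \<subseteq> \<Union>M"

definition independence_number :: "'a graph \<Rightarrow> nat" where
  "independence_number G = Max {card S | S. S \<subseteq> verts G \<and> indep S (edges G)}"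

definition token_graph :: "nat \<Rightarrow> 'a graph \<Rightarrow> 'a set graph" where
  "token_graph k G =
     \<lparr> verts = [verts G]\<^bsup>k\<^esup>,
       edges = {{X, Y} | X Y. X \<in> [verts G]\<^bsup>k\<^esup> \<and> Y \<in> [verts G]\<^bsup>k\<^esup> \<and> sym_diff X Y \<in> edges G} \<rparr>"

lemma fin_simple_graph_token_graph:
  assumes "fin_simple_graph G"
  shows "fin_simple_graph (token_graph k G)"
proof -
  have "{X, Y} \<in> [[verts G]\<^bsup>k\<^esup>]\<^bsup>2\<^esup>"
    if "X \<in> [verts G]\<^bsup>k\<^esup>" "Y \<in> [verts G]\<^bsup>k\<^esup>" "sym_diff X Y \<in> edges G" for X Y
  proof -
    have "sym_diff X Y \<noteq> {}"
      using that(3) assms by (auto simp: fin_simple_graph_def nsets_def)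
    then have "X \<noteq> Y" by auto
    with that(1,2) show ?thesis
      by (auto simp: nsets_2_eq)
  qed
  moreover have "finite ([verts G]\<^bsup>k\<^esup>)"
    using assms by (simp add: fin_simple_graph_def finite_imp_finite_nsets)
  ultimately show ?thesis
    unfolding fin_simple_graph_def token_graph_def by auto
qed

end

theory Submission
  imports Defs
begin

text \<open>
  Let \<open>M\<close> be a perfect matching of \<open>G\<close>. Since \<open>k\<close> is odd, every \<open>k\<close>-set \<open>X\<close> of vertices meets some
  edge of \<open>M\<close> in exactly one vertex. Choose such an edge and move the token of \<open>X\<close> to its other end.
  This does not change the set of edges of \<open>M\<close> met in exactly one vertex, so if the
  choice depends only on that set, the move is an involution; it pairs each vertex of the token
  graph with a neighbour, which gives the upper bound. The token graph is bipartite according to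
  the parity of \<open>card (X \<inter> B)\<close>, and the involution exchanges its two sides, so each side is an
  independent set containing exactly half of the vertices.
\<close>

text \<open>For two-element edges, odd means exactly one end in \<open>X\<close>. The parity form
  lets the existence of such an edge be read off from a sum of cardinalities.\<close>

definition split_edges :: "'a set set \<Rightarrow> 'a set \<Rightarrow> 'a set set" where
  "split_edges M X = {e \<in> M. odd (card (e \<inter> X))}"

definition slide :: "'a set set \<Rightarrow> 'a set \<Rightarrow> 'a set" where
  "slide M X = sym_diff X (SOME e. e \<in> split_edges M X)"

text \<open>The disjoint members of \<open>M\<close> cut \<open>X\<close> into the pieces
  \<open>e \<inter> X\<close>, so \<open>card X\<close> is the sum of their sizes, and an odd sum
  has an odd summand.\<close>

lemma split_edges_nonempty:
  assumes "finite M" "pairwise disjnt M" "finite X" "X \<subseteq> \<Union>M" "odd (card X)"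
  shows "split_edges M X \<noteq> {}"
proof
  assume "split_edges M X = {}"
  then have ev: "\<forall>e\<in>M. even (card (e \<inter> X))"
    by (auto simp: split_edges_def)
  have "X = (\<Union>e\<in>M. e \<inter> X)"
    using assms(4) by blast
  also have "card \<dots> = (\<Sum>e\<in>M. card (e \<inter> X))"
    using assms(1-3) by (intro card_UN_disjoint) (auto simp: pairwise_def disjnt_def)
  finally have "even (card X)"
    using ev by (simp add: dvd_sum)
  with assms(5) show False by simp
qed

lemma split_edgeE:
  assumes "e \<in> split_edges M X" "card e = 2"
  obtains a b where "e = {a, b}" "a \<in> X" "b \<notin> X"
proof -
  obtain a b where e: "e = {a, b}" "a \<noteq> b"
    using assms(2) by (auto simp: card_2_iff)
  have "odd (card ({a, b} \<inter> X))"
    using assms(1) e by (simp add: split_edges_def)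
  then have "a \<in> X \<and> b \<notin> X \<or> b \<in> X \<and> a \<notin> X"
    using e(2) by (cases "a \<in> X"; cases "b \<in> X") auto
  then show thesis
    using that e(1) by (metis insert_commute)
qed

text \<open>On \<open>e\<close> itself the occupied end is swapped for the free one, so one end
  stays occupied; every other member of \<open>M\<close> is disjoint from \<open>e\<close> and sees
  no change.\<close>

lemma split_edges_sym_diff:
  assumes "pairwise disjnt M" "e \<in> split_edges M X" "card e = 2"
  shows "split_edges M (sym_diff X e) = split_edges M X"
proof -
  obtain a b where e: "e = {a, b}" "a \<in> X" "b \<notin> X"
    using split_edgeE assms(2,3) by blast
  have "odd (card (f \<inter> sym_diff X e)) \<longleftrightarrow> odd (card (f \<inter> X))" if "f \<in> M" for f
  proof (cases "f = e")
    case True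
    have "{a, b} \<inter> sym_diff X {a, b} = {b}" "{a, b} \<inter> X = {a}"
      using e by auto
    then show ?thesis
      using True e(1) by simp
  next
    case False
    then have "f \<inter> e = {}"
      using assms(1,2) that by (auto simp: pairwise_def disjnt_def split_edges_def)
    then have "f \<inter> sym_diff X e = f \<inter> X" by blast
    then show ?thesis by simp
  qed
  then show ?thesis
    by (auto simp: split_edges_def)
qed

lemma card_sym_diff_split_edge:
  assumes "finite X" "e \<in> split_edges M X" "card e = 2"
  shows "card (sym_diff X e) = card X"
proof -
  obtain a b where e: "e = {a, b}" "a \<in> X" "b \<notin> X"
    using split_edgeE assms(2,3) by blast
  then have "sym_diff X e = insert b (X - {a})" by auto
  then show ?thesis
    using e(2,3) assms(1) by (metis card_Suc_Diff1 card_insert_disjoint finite_Diff Diff_iff)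
qed

lemma slide_perfect_matching:
  assumes G: "fin_simple_graph G" "perfect_matching G M"
    and X: "X \<in> [verts G]\<^bsup>k\<^esup>" "odd k"
  shows "slide M X \<in> [verts G]\<^bsup>k\<^esup>" "sym_diff X (slide M X) \<in> edges G" "slide M (slide M X) = X"
proof -
  let ?e = "SOME e. e \<in> split_edges M X"
  have M: "M \<subseteq> [verts G]\<^bsup>2\<^esup>" "M \<subseteq> edges G" "pairwise disjnt M" "verts G \<subseteq> \<Union>M"
    using G by (auto simp: fin_simple_graph_def perfect_matching_def matching_def
        pairwise_def disjnt_def)
  have "finite M"
    using M(1) G(1) by (meson fin_simple_graph_def finite_imp_finite_nsets finite_subset)
  then have e: "?e \<in> split_edges M X"
    using split_edges_nonempty[of M X] M(3,4) X by (auto simp: nsets_def some_in_eq)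
  then have eM: "?e \<in> M"
    by (auto simp: split_edges_def)
  then have e2: "card ?e = 2" "?e \<subseteq> verts G"
    using M(1) by (auto simp: nsets_def)
  show "slide M X \<in> [verts G]\<^bsup>k\<^esup>"
    using X(1) e2 card_sym_diff_split_edge[OF _ e] finite_subset[OF e2(2)] G(1)
    by (auto simp: slide_def nsets_def fin_simple_graph_def)
  have *: "sym_diff X (sym_diff X A) = A" "sym_diff (sym_diff X A) A = X" for A
    by auto
  show "sym_diff X (slide M X) \<in> edges G"
    unfolding slide_def * using eM M(2) by auto
  \<comment> \<open>\<open>SOME\<close> is applied to the same set before and after the move, so it
    returns the same edge, and adding that edge twice by symmetric difference cancels.\<close>
  have "split_edges M (slide M X) = split_edges M X"
    unfolding slide_def by (rule split_edges_sym_diff[OF M(3) e e2(1)])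
  then have "slide M (slide M X) = sym_diff (slide M X) ?e"
    by (simp add: slide_def)
  then show "slide M (slide M X) = X"
    unfolding slide_def * .
qed

text \<open>An edge has exactly one end in \<open>B\<close>, so along it \<open>X \<inter> B\<close>
  and \<open>Y \<inter> B\<close> differ in a single vertex.\<close>

lemma parity_sym_diff_bipartition:
  assumes "bipartition G B R" "finite X" "finite Y" "sym_diff X Y \<in> edges G"
  shows "even (card (X \<inter> B)) \<longleftrightarrow> odd (card (Y \<inter> B))"
proof -
  \<comment> \<open>Stated for arbitrary sets so that it also serves with \<open>X\<close> and
    \<open>Y\<close> exchanged, when the vertex \<open>b\<close> lies in \<open>Y\<close>.\<close>
  have main: "even (card (X \<inter> B)) \<longleftrightarrow> odd (card (Y \<inter> B))"
    if "sym_diff X Y \<inter> B = {b}" "b \<in> X" "finite X" for X Y b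
  proof -
    have "X \<inter> B = insert b (Y \<inter> B)" "b \<notin> Y \<inter> B"
      using that(1,2) by blast+
    with that(3) show ?thesis
      by (metis card_insert_disjoint even_Suc finite_Int finite_insert)
  qed
  obtain b r where "b \<in> B" "r \<in> R" "sym_diff X Y = {b, r}"
    using assms(1,4) by (auto simp: bipartition_def)
  then have *: "sym_diff X Y \<inter> B = {b}"
    using assms(1) by (auto simp: bipartition_def)
  then have "b \<in> X \<or> b \<in> Y" by blast
  then show ?thesis
    using main[OF * _ assms(2)] main[of Y X b] * assms(3) by (auto simp: Un_commute)
qed

theorem theorem3p6:
  fixes G :: "'a graph" and B R :: "'a set" and m n k :: nat
  assumes "fin_simple_graph G"
    and "bipartition G B R"
    and "m = card B" and "n = card R"
    and "m \<ge> 1" and "n \<ge> 1" and "m \<le> n"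
    and "1 \<le> k" and "k \<le> m + n - 1"
    and "\<exists>M. perfect_matching G M"
    and "odd k"
  shows "real (independence_number (token_graph k G)) = real ((m + n) choose k) / 2"
proof -
  obtain M where M: "perfect_matching G M"
    using assms(10) by blast
  let ?V = "[verts G]\<^bsup>k\<^esup>"
  define E where "E = {{X, Y} | X Y. X \<in> ?V \<and> Y \<in> ?V \<and> sym_diff X Y \<in> edges G}"
  let ?\<phi> = "slide M"
  note slide = slide_perfect_matching[OF assms(1) M _ assms(11)]
  have fin: "finite (verts G)" "finite ?V"
    using assms(1) by (auto simp: fin_simple_graph_def finite_imp_finite_nsets)
  have finV: "finite X" if "X \<in> ?V" for X
    using that by (simp add: nsets_def)
  have "card (verts G) = m + n"
    using assms(2-4) fin(1) by (metis bipartition_def card_Un_disjoint finite_Un)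
  then have cardV: "card ?V = (m + n) choose k"
    by (simp add: card_nsets)
  have inj: "inj_on ?\<phi> ?V"
    using slide(3) by (metis inj_onI)
  \<comment> \<open>\<open>indep\<close> only restricts pairs of distinct vertices, hence the second
    fact.\<close>
  have nbr: "{X, ?\<phi> X} \<in> E" "?\<phi> X \<noteq> X" if "X \<in> ?V" for X
    using that slide(1,2)[OF that] assms(1) by (auto simp: E_def fin_simple_graph_def nsets_def)
  have upper: "2 * card S \<le> card ?V" if S: "S \<subseteq> ?V" "indep S E" for S
  proof -
    have "?\<phi> X \<notin> S" if "X \<in> S" for X
    proof
      assume "?\<phi> X \<in> S"
      moreover have "X \<in> ?V" using that S(1) by (rule subsetD[rotated])
      ultimately show False
        using S(2) that nbr[of X] by (auto simp: indep_def)
    qed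
    \<comment> \<open>An independent set and its injective image are thus disjoint sets of equal
      size inside \<open>?V\<close>.\<close>
    then have "S \<inter> ?\<phi> ` S = {}" by blast
    then have "card (S \<union> ?\<phi> ` S) = 2 * card S"
      using finite_subset[OF S(1) fin(2)] inj_on_subset[OF inj S(1)]
      by (simp add: card_Un_disjoint card_image)
    moreover have "S \<union> ?\<phi> ` S \<subseteq> ?V"
      using S(1) slide(1) by auto
    ultimately show ?thesis
      using card_mono[OF fin(2), of "S \<union> ?\<phi> ` S"] by simp
  qed
  define side where "side p = {X \<in> ?V. even (card (X \<inter> B)) \<longleftrightarrow> p}" for p
  have side_sub: "side p \<subseteq> ?V" for p
    by (auto simp: side_def)
  have side_indep: "indep (side p) E" for p
  proof -
    have "\<not> sym_diff X Y \<in> edges G" if "X \<in> side p" "Y \<in> side p" for X Y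
      using that parity_sym_diff_bipartition[OF assms(2), of X Y] finV by (auto simp: side_def)
    then show ?thesis
      by (auto simp: indep_def E_def doubleton_eq_iff)
  qed
  have "?\<phi> ` side p \<subseteq> side (\<not> p)" for p
    using slide(1) parity_sym_diff_bipartition[OF assms(2) _ _ slide(2)] finV
    by (auto simp: side_def)
  \<comment> \<open>The injection works in both directions, so the two sides have equal
    size.\<close>
  then have "card (side p) \<le> card (side (\<not> p))" for p
    by (meson card_inj_on_le finite_subset fin(2) side_sub inj_on_subset inj)
  from this[of True] this[of False] have "card (side True) = card (side False)"
    by simp
  moreover have "?V = side True \<union> side False" "side True \<inter> side False = {}"
    by (auto simp: side_def)
  ultimately have half: "card ?V = 2 * card (side True)"
    using fin(2) by (metis card_Un_disjoint finite_Un mult_2)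
  have "independence_number (token_graph k G) = Max {card S | S. S \<subseteq> ?V \<and> indep S E}"
    by (simp add: independence_number_def token_graph_def E_def)
  also have "\<dots> = card (side True)"
  proof (rule Max_eqI)
    show "finite {card S | S. S \<subseteq> ?V \<and> indep S E}"
      using fin(2) by simp
    show "y \<le> card (side True)" if y: "y \<in> {card S | S. S \<subseteq> ?V \<and> indep S E}" for y
    proof -
      obtain S where "y = card S" "S \<subseteq> ?V" "indep S E"
        using y by blast
      then show ?thesis
        using upper[of S] half by simp
    qed
    show "card (side True) \<in> {card S | S. S \<subseteq> ?V \<and> indep S E}"
      using side_sub side_indep by blast
  qed
  finally show ?thesis
    using half cardV by simp
qed

end
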